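(* Let $w^1,\dots,w^m>0$ be weights and let $(V,E)$ be a simple directed graph with vertex set $V=\{1,\dots,m\}$ and edge set $E\subset V\times V$ (no loops). Then the isotonic regression cone $$K^w_E=\left\{x\in\mathbb{R}^m:\ \frac{x^i}{\sqrt{w^i}}\le\frac{x^j}{\sqrt{w^j}}\ \text{ for all } (i,j)\in E\right\}$$ is an $\mathbb{R}^m_+$-isotonic projection set; that is, for all $u,v\in\mathbb{R}^m$ with $u\le_{\mathbb{R}^m_+}v$ one has $P_{K^w_E}u\le_{\mathbb{R}^m_+}P_{K^w_E}v$.
   Context: $\mathbb{R}^m$ carries the standard scalar product and the Euclidean norm $\|\cdot\|$; coordinates of vectors are written with upper indices, $x=(x^1,\dots,x^m)$, and $w^i$ denotes the $i$-th weight (not a power). $\mathbb{R}^m_+=\{x\in\mathbb{R}^m: x^i\ge 0,\ i=1,\dots,m\}$ is the nonnegative orthant, and the coordinate-wise ordering is $x\le_{\mathbb{R}^m_+}y \iff y-x\in\mathbb{R}^m_+$, i.e. $x^i\le y^i$ for all $i$. For a nonempty closed convex set $D\subset\mathbb{R}^m$, $P_D:\mathbb{R}^m\to D$ denotes the metric projection: $P_Dx$ is the unique point of $D$ with $\|x-P_Dx\|=\inf\{\|x-y\|: y\in D\}$. The set $D$ is called an $\mathbb{R}^m_+$-isotonic projection set if for all $x,y\in\mathbb{R}^m$, $x\le_{\mathbb{R}^m_+}y$ implies $P_Dx\le_{\mathbb{R}^m_+}P_Dy$. *)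

theory Defs
  imports "HOL-Analysis.Analysis"
begin

text \<open>The metric projection onto \<open>D\<close> is \<^const>\<open>closest_point\<close>, and the ordering of
  \<^typ>\<open>real ^ 'm\<close> by the nonnegative orthant is the coordinate-wise library order.\<close>

lemma orthant_order:
  fixes x y :: "real ^ 'm"
  shows "x \<le> y \<longleftrightarrow> y - x \<in> {z. \<forall>i. 0 \<le> z $ i}"
  by (simp add: less_eq_vec_def)

lemma closest_point_metric_projection:
  fixes D :: "(real ^ 'm) set"
  assumes "D \<noteq> {}" "closed D" "convex D"
  shows "closest_point D x = p \<longleftrightarrow> p \<in> D \<and> norm (x - p) = (INF y\<in>D. norm (x - y))"
proof -
  have inf: "norm (x - p) = (INF y\<in>D. norm (x - y)) \<longleftrightarrow> (\<forall>y\<in>D. dist x p \<le> dist x y)"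
    if "p \<in> D" for p
  proof
    assume "norm (x - p) = (INF y\<in>D. norm (x - y))"
    moreover have "bdd_below ((\<lambda>y. norm (x - y)) ` D)"
      by (rule bdd_belowI2[of _ 0]) simp
    ultimately show "\<forall>y\<in>D. dist x p \<le> dist x y"
      by (metis cINF_lower dist_norm)
  next
    assume "\<forall>y\<in>D. dist x p \<le> dist x y"
    then show "norm (x - p) = (INF y\<in>D. norm (x - y))"
      using that by (intro cInf_eq_minimum[symmetric]) (auto simp: dist_norm)
  qed
  show ?thesis
    using inf closest_point_exists[OF assms(2,1), of x] closest_point_unique[OF assms(3,2)]
    by metis
qed

definition isotonic_projection_set :: "(real ^ 'm) set \<Rightarrow> bool" where
  "isotonic_projection_set D \<longleftrightarrow>
     D \<noteq> {} \<and> closed D \<and> convex D \<and>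
     (\<forall>x y. x \<le> y \<longrightarrow> closest_point D x \<le> closest_point D y)"

definition isotonic_regression_cone :: "real ^ 'm \<Rightarrow> ('m \<times> 'm) set \<Rightarrow> (real ^ 'm) set" where
  "isotonic_regression_cone w E =
     {x. \<forall>(i, j)\<in>E. x $ i / sqrt (w $ i) \<le> x $ j / sqrt (w $ j)}"

end

theory Submission
  imports Defs
begin

text \<open>The cone is a closed convex sublattice of \<open>\<real>\<^sup>m\<close>, and this suffices. Let \<open>u \<le> v\<close> have the
  projections \<open>p\<close> and \<open>q\<close>. Replacing \<open>(p, q)\<close> by \<open>(inf p q, sup p q)\<close> does not increase
  \<open>\<parallel>u - p\<parallel>\<^sup>2 + \<parallel>v - q\<parallel>\<^sup>2\<close>; by minimality of \<open>p\<close>, the point \<open>sup p q\<close> is then at least as close to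
  \<open>v\<close> as \<open>q\<close>, so \<open>sup p q = q\<close> by uniqueness of the projection.\<close>

lemma norm_power2_vec_eq_sum:
  fixes x :: "real ^ 'm"
  shows "(norm x)\<^sup>2 = (\<Sum>i\<in>UNIV. (x $ i)\<^sup>2)"
  unfolding power2_norm_eq_inner inner_vec_def by (simp add: power2_eq_square)

text \<open>The inequality holds coordinate by coordinate. Where \<open>p $ i \<le> q $ i\<close>
  nothing changes; otherwise the two values are swapped, and the right side exceeds the left by
  \<open>2 * (v $ i - u $ i) * (p $ i - q $ i)\<close>.\<close>

lemma norm_inf_sup_exchange:
  fixes u v p q :: "real ^ 'm"
  assumes "u \<le> v"
  shows "(norm (u - inf p q))\<^sup>2 + (norm (v - sup p q))\<^sup>2 \<le> (norm (u - p))\<^sup>2 + (norm (v - q))\<^sup>2"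
proof -
  have "(u $ i - inf (p $ i) (q $ i))\<^sup>2 + (v $ i - sup (p $ i) (q $ i))\<^sup>2
      \<le> (u $ i - p $ i)\<^sup>2 + (v $ i - q $ i)\<^sup>2" for i
  proof (cases "p $ i \<le> q $ i")
    case False
    moreover have "u $ i \<le> v $ i"
      using assms by (simp add: less_eq_vec_def)
    ultimately have "0 \<le> (v $ i - u $ i) * (p $ i - q $ i)"
      by simp
    with False show ?thesis
      by (simp add: inf_min sup_max power2_eq_square algebra_simps)
  qed (simp add: inf_absorb1 sup_absorb2)
  then show ?thesis
    by (simp add: norm_power2_vec_eq_sum inf_vec_def sup_vec_def sum_mono flip: sum.distrib)
qed

lemma isotonic_projection_set_sublattice:
  fixes D :: "(real ^ 'm) set"
  assumes "D \<noteq> {}" "closed D" "convex D"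
    and inf: "\<And>x y. x \<in> D \<Longrightarrow> y \<in> D \<Longrightarrow> inf x y \<in> D"
    and sup: "\<And>x y. x \<in> D \<Longrightarrow> y \<in> D \<Longrightarrow> sup x y \<in> D"
  shows "isotonic_projection_set D"
  unfolding isotonic_projection_set_def
proof (intro conjI allI impI)
  fix u v :: "real ^ 'm"
  assume "u \<le> v"
  define p q where "p = closest_point D u" and "q = closest_point D v"
  have pq: "p \<in> D" "q \<in> D"
    using assms(1,2) by (simp_all add: p_def q_def closest_point_in_set)
  have "dist u p \<le> dist u (inf p q)"
    unfolding p_def using assms(2) pq inf by (intro closest_point_le) (simp_all add: p_def)
  then have "(norm (u - p))\<^sup>2 \<le> (norm (u - inf p q))\<^sup>2"
    by (simp add: dist_norm power_mono)
  with norm_inf_sup_exchange[OF \<open>u \<le> v\<close>, of p q]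
  have "(norm (v - sup p q))\<^sup>2 \<le> (norm (v - q))\<^sup>2"
    by linarith
  then have "dist v (sup p q) \<le> dist v q"
    by (simp add: dist_norm)
  then have "\<forall>z\<in>D. dist v (sup p q) \<le> dist v z"
    using closest_point_le[OF assms(2)] unfolding q_def by (meson order_trans)
  then have "sup p q = q"
    unfolding q_def using closest_point_unique[OF assms(3,2)] sup pq q_def by blast
  then show "closest_point D u \<le> closest_point D v"
    unfolding p_def q_def by (simp add: sup.absorb_iff2)
qed (use assms in auto)

text \<open>Reduces closedness and convexity to the linear inequality of a single edge.\<close>

lemma isotonic_regression_cone_eq_Inter:
  "isotonic_regression_cone w E =
    (\<Inter>(i, j)\<in>E. {x. x $ i / sqrt (w $ i) \<le> x $ j / sqrt (w $ j)})"
  by (auto simp: isotonic_regression_cone_def)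

lemma closed_isotonic_regression_cone: "closed (isotonic_regression_cone w E)"
  unfolding isotonic_regression_cone_eq_Inter divide_inverse
  by (auto intro!: closed_INT closed_Collect_le continuous_intros)

lemma convex_isotonic_regression_cone: "convex (isotonic_regression_cone w E)"
proof -
  have "convex {x. x $ i / sqrt (w $ i) \<le> x $ j / sqrt (w $ j)}" for i j
    \<comment> \<open>Pulling the convex coefficients out of the quotients leaves a nonnegative
      combination of the two given inequalities.\<close>
    by (auto simp: convex_def add_divide_distrib intro!: add_mono mult_left_mono
        simp flip: times_divide_eq_right)
  then show ?thesis
    unfolding isotonic_regression_cone_eq_Inter by (auto intro!: convex_INT)
qed

text \<open>Division by a positive constant is increasing, so it commutes with the lattice
  operations.\<close>

lemma inf_sup_divide_pos:
  fixes a b c :: real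
  assumes "c > 0"
  shows "inf a b / c = inf (a / c) (b / c)" "sup a b / c = sup (a / c) (b / c)"
  using assms by (auto simp: inf_min sup_max min_def max_def field_simps)

theorem corollary1:
  fixes w :: "real ^ 'm" and E :: "('m \<times> 'm) set"
  assumes "\<And>i. w $ i > 0"
    and "irrefl E"
  shows "isotonic_projection_set (isotonic_regression_cone w E)"
proof (rule isotonic_projection_set_sublattice)
  have "0 \<in> isotonic_regression_cone w E"
    by (auto simp: isotonic_regression_cone_def)
  then show "isotonic_regression_cone w E \<noteq> {}"
    by blast
next
  fix x y
  assume "x \<in> isotonic_regression_cone w E" "y \<in> isotonic_regression_cone w E"
  then show "inf x y \<in> isotonic_regression_cone w E" "sup x y \<in> isotonic_regression_cone w E"
    \<comment> \<open>Positive weights let the scaling by \<open>sqrt (w $ i)\<close> pass through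
      \<open>inf\<close> and \<open>sup\<close>, which are monotone in both arguments and so
      preserve each edge inequality.\<close>
    using assms(1)
    by (fastforce simp: isotonic_regression_cone_def inf_vec_def sup_vec_def inf_sup_divide_pos
        intro: le_infI1 le_infI2 le_supI1 le_supI2)+
qed (rule closed_isotonic_regression_cone convex_isotonic_regression_cone)+

end
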